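(* Let $(Z,d)$ be a Polish metric space and let $L\subseteq Z$ be a fixed finite set (of landmarks). Given two non-empty finite point clouds $Y_1,Y_2\subseteq Z$, we have $$d_{HI}\big(\mathcal{MD}(L,\nu_{Y_1}),\mathcal{MD}(L,\nu_{Y_2})\big)\le d_{Pr}(\nu_{Y_1},\nu_{Y_2}),$$ where $\nu_Y=\frac1{|Y|}\sum_{y\in Y}\delta_y$ is the empirical probability measure.
   Context: Measure Dowker bifiltration: for $X\subseteq Z$, a Borel measure $\mu$ on $Z$, $m\in\,]0,\infty[$ and $r\in[0,\infty[$, $\mathcal{MD}(X,\mu)_{m,r}$ is the abstract simplicial complex of all non-empty finite $\sigma\subseteq X$ with $\mu(\{z\in Z:d(x,z)\le 2r\ \text{for all }x\in\sigma\})\ge m$. It is a functor on the poset $T'=\,]0,\infty[^{op}\times[0,\infty[$ (order: $(m,r)\le(m',r')$ iff $m\ge m'$ and $r\le r'$) with inclusions as structure maps. $d_{HI}$ is applied to its geometric realization. Prokhorov metric: $d_{Pr}(\mu,\eta)=\inf\{\varepsilon>0:\mu(A)\le\eta(A^\varepsilon)+\varepsilon\text{ and }\eta(A)\le\mu(A^\varepsilon)+\varepsilon\text{ for all closed }A\subseteq Z\}$, where $A^\varepsilon=\{z\in Z:\exists a\in A,\ d(a,z)\le\varepsilon\}$. Homotopy interleaving distance: for $\delta>0$ let $\alpha(m,r)=(m-\delta,r+\delta)$ on $\mathbb R^{op}\times[0,\infty[$ (order given by the same formula). The interleaving category is the thin category with objects $T'\times\{0,1\}$ and a (unique) morphism $(p,i)\to(q,j)$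 iff either $i=j$ and $p\le q$, or $i\ne j$ and $\alpha(p)\le q$. Functors $F,G:T'\to\mathbf{Top}$ ($\mathbf{Top}$: compactly generated weakly Hausdorff spaces) are $\delta$-interleaved if there is a functor from the interleaving category to $\mathbf{Top}$ restricting to $F$ on $T'\times\{0\}$ and to $G$ on $T'\times\{1\}$. Weak equivalence $F\simeq F'$ means connected by a finite zig-zag of natural transformations whose components are all homotopy equivalences. Then $d_{HI}(F,G)=\inf\{\delta>0:\exists F'\simeq F,\ G'\simeq G\text{ with }F',G'\ \delta\text{-interleaved}\}$ (with $\inf\emptyset=\infty$). *)

theory Defs
  imports "HOL-Probability.Probability"
begin

section \<open>Geometric realization\<close>

definition closed_simplex :: "'v set \<Rightarrow> ('v \<Rightarrow> real) set" where
  "closed_simplex \<sigma> = {t. (\<forall>v. 0 \<le> t v) \<and> (\<forall>v. v \<notin> \<sigma> \<longrightarrow> t v = 0) \<and> (\<Sum>v\<in>\<sigma>. t v) = 1}"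

text \<open>
  An abstract simplicial complex is given by its set of (non-empty, finite) simplices, and a point
  of the realization by its barycentric coordinates. The topology is the weak one, coherent with
  the closed simplices; on a closed simplex the product topology of \<^typ>\<open>'v \<Rightarrow> real\<close> is the usual
  Euclidean topology, the simplex being finite.
\<close>

definition realization :: "'v set set \<Rightarrow> ('v \<Rightarrow> real) topology" where
  "realization K = topology (\<lambda>U. U \<subseteq> (\<Union>\<sigma>\<in>K. closed_simplex \<sigma>) \<and>
     (\<forall>\<sigma>\<in>K. openin (top_of_set (closed_simplex \<sigma>)) (U \<inter> closed_simplex \<sigma>)))"

lemma openin_realization:
  "openin (realization K) U \<longleftrightarrow> U \<subseteq> (\<Union>\<sigma>\<in>K. closed_simplex \<sigma>) \<and>
     (\<forall>\<sigma>\<in>K. openin (top_of_set (closed_simplex \<sigma>)) (U \<inter> closed_simplex \<sigma>))"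
proof -
  have "istopology (\<lambda>U. U \<subseteq> (\<Union>\<sigma>\<in>K. closed_simplex \<sigma>) \<and>
     (\<forall>\<sigma>\<in>K. openin (top_of_set (closed_simplex \<sigma>)) (U \<inter> closed_simplex \<sigma>)))"
    unfolding istopology_def
  proof (intro conjI allI impI ballI)
    fix S T \<sigma>
    assume ST: "S \<subseteq> (\<Union>\<sigma>\<in>K. closed_simplex \<sigma>) \<and>
        (\<forall>\<sigma>\<in>K. openin (top_of_set (closed_simplex \<sigma>)) (S \<inter> closed_simplex \<sigma>))"
      "T \<subseteq> (\<Union>\<sigma>\<in>K. closed_simplex \<sigma>) \<and>
        (\<forall>\<sigma>\<in>K. openin (top_of_set (closed_simplex \<sigma>)) (T \<inter> closed_simplex \<sigma>))"
    show "S \<inter> T \<subseteq> (\<Union>\<sigma>\<in>K. closed_simplex \<sigma>)" using ST by blast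
    assume \<sigma>: "\<sigma> \<in> K"
    have "openin (top_of_set (closed_simplex \<sigma>))
        ((S \<inter> closed_simplex \<sigma>) \<inter> (T \<inter> closed_simplex \<sigma>))"
      by (rule openin_Int) (use ST \<sigma> in blast)+
    moreover have "(S \<inter> closed_simplex \<sigma>) \<inter> (T \<inter> closed_simplex \<sigma>) = (S \<inter> T) \<inter> closed_simplex \<sigma>"
      by blast
    ultimately show "openin (top_of_set (closed_simplex \<sigma>)) ((S \<inter> T) \<inter> closed_simplex \<sigma>)"
      by simp
  next
    fix \<U> \<sigma>
    assume U: "\<forall>U\<in>\<U>. U \<subseteq> (\<Union>\<sigma>\<in>K. closed_simplex \<sigma>) \<and>
        (\<forall>\<sigma>\<in>K. openin (top_of_set (closed_simplex \<sigma>)) (U \<inter> closed_simplex \<sigma>))"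
    show "\<Union>\<U> \<subseteq> (\<Union>\<sigma>\<in>K. closed_simplex \<sigma>)" using U by blast
    assume "\<sigma> \<in> K"
    then have "openin (top_of_set (closed_simplex \<sigma>)) (\<Union>U\<in>\<U>. U \<inter> closed_simplex \<sigma>)"
      using U by (intro openin_Union) auto
    then show "openin (top_of_set (closed_simplex \<sigma>)) (\<Union>\<U> \<inter> closed_simplex \<sigma>)"
      by simp
  qed
  then show ?thesis
    unfolding realization_def by (simp add: topology_inverse')
qed

lemma topspace_realization: "topspace (realization K) = (\<Union>\<sigma>\<in>K. closed_simplex \<sigma>)"
proof
  show "topspace (realization K) \<subseteq> (\<Union>\<sigma>\<in>K. closed_simplex \<sigma>)"
    using openin_realization openin_topspace by blast
  have "openin (realization K) (\<Union>\<sigma>\<in>K. closed_simplex \<sigma>)"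
    unfolding openin_realization
  proof (intro conjI ballI subset_refl)
    fix \<sigma> assume "\<sigma> \<in> K"
    then have "(\<Union>\<tau>\<in>K. closed_simplex \<tau>) \<inter> closed_simplex \<sigma> = closed_simplex \<sigma>" by blast
    then show "openin (top_of_set (closed_simplex \<sigma>))
        ((\<Union>\<tau>\<in>K. closed_simplex \<tau>) \<inter> closed_simplex \<sigma>)" by simp
  qed
  then show "(\<Union>\<sigma>\<in>K. closed_simplex \<sigma>) \<subseteq> topspace (realization K)"
    by (rule openin_subset)
qed


section \<open>Compactly generated weakly Hausdorff spaces\<close>

text \<open>
  Both notions quantify over maps from arbitrary compact Hausdorff spaces. Test spaces on subsets
  of \<^typ>\<open>'a set set\<close> suffice: in the first definition one may replace the test space by the closure
  of a set of representatives of the fibres, and a Hausdorff space with a dense subset of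
  cardinality \<open>c\<close> has at most \<open>2^(2^c)\<close> points; in a weakly Hausdorff space the image of a test
  map is a compact Hausdorff subspace, of which the test space is a quotient, so in the second one
  may replace the test space by a subspace of \<open>X\<close>.
\<close>

definition weakly_Hausdorff_space :: "'a topology \<Rightarrow> bool" where
  "weakly_Hausdorff_space X \<longleftrightarrow>
     (\<forall>(C :: 'a set set topology) u.
        compact_space C \<and> Hausdorff_space C \<and> continuous_map C X u \<longrightarrow>
        closedin X (u ` topspace C))"

definition compactly_generated_space :: "'a topology \<Rightarrow> bool" where
  "compactly_generated_space X \<longleftrightarrow>
     (\<forall>A \<subseteq> topspace X.
        (\<forall>(C :: 'a set set topology) u.
           compact_space C \<and> Hausdorff_space C \<and> continuous_map C X u \<longrightarrow>
           closedin C {c \<in> topspace C. u c \<in> A}) \<longrightarrow>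
        closedin X A)"

definition CGWH_space :: "'a topology \<Rightarrow> bool" where
  "CGWH_space X \<longleftrightarrow> compactly_generated_space X \<and> weakly_Hausdorff_space X"


section \<open>Functors from thin categories to spaces\<close>

text \<open>
  A thin category is given by its set \<open>P\<close> of objects and a relation \<open>le\<close> (a preorder on \<open>P\<close>) holding
  between two objects iff there is a morphism. Maps of spaces are compared on the underlying set
  of their domain only. All spaces of a diagram, and of diagrams compared to it, live in one type
  \<^typ>\<open>'a\<close>.
\<close>

record ('i, 'a) diagram =
  obj :: "'i \<Rightarrow> 'a topology"
  mor :: "'i \<Rightarrow> 'i \<Rightarrow> 'a \<Rightarrow> 'a"

definition top_functor :: "'i set \<Rightarrow> ('i \<Rightarrow> 'i \<Rightarrow> bool) \<Rightarrow> ('i, 'a) diagram \<Rightarrow> bool" where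
  "top_functor P le F \<longleftrightarrow>
     (\<forall>p\<in>P. CGWH_space (obj F p)) \<and>
     (\<forall>p\<in>P. \<forall>q\<in>P. le p q \<longrightarrow> continuous_map (obj F p) (obj F q) (mor F p q)) \<and>
     (\<forall>p\<in>P. \<forall>x\<in>topspace (obj F p). mor F p p x = x) \<and>
     (\<forall>p\<in>P. \<forall>q\<in>P. \<forall>r\<in>P. le p q \<longrightarrow> le q r \<longrightarrow>
        (\<forall>x\<in>topspace (obj F p). mor F q r (mor F p q x) = mor F p r x))"

definition natural_transformation ::
  "'i set \<Rightarrow> ('i \<Rightarrow> 'i \<Rightarrow> bool) \<Rightarrow> ('i, 'a) diagram \<Rightarrow> ('i, 'a) diagram \<Rightarrow> ('i \<Rightarrow> 'a \<Rightarrow> 'a) \<Rightarrow> bool"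
where
  "natural_transformation P le F G \<eta> \<longleftrightarrow>
     (\<forall>p\<in>P. continuous_map (obj F p) (obj G p) (\<eta> p)) \<and>
     (\<forall>p\<in>P. \<forall>q\<in>P. le p q \<longrightarrow>
        (\<forall>x\<in>topspace (obj F p). \<eta> q (mor F p q x) = mor G p q (\<eta> p x)))"

definition homotopy_equivalence :: "'a topology \<Rightarrow> 'b topology \<Rightarrow> ('a \<Rightarrow> 'b) \<Rightarrow> bool" where
  "homotopy_equivalence X Y f \<longleftrightarrow>
     continuous_map X Y f \<and>
     (\<exists>g. continuous_map Y X g \<and>
          homotopic_with (\<lambda>x. True) X X (g \<circ> f) id \<and>
          homotopic_with (\<lambda>x. True) Y Y (f \<circ> g) id)"

definition elementary_equivalence ::
  "'i set \<Rightarrow> ('i \<Rightarrow> 'i \<Rightarrow> bool) \<Rightarrow> ('i, 'a) diagram \<Rightarrow> ('i, 'a) diagram \<Rightarrow> bool"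
where
  "elementary_equivalence P le F G \<longleftrightarrow>
     top_functor P le F \<and> top_functor P le G \<and>
     (\<exists>\<eta>. natural_transformation P le F G \<eta> \<and>
          (\<forall>p\<in>P. homotopy_equivalence (obj F p) (obj G p) (\<eta> p)))"

definition weakly_equivalent ::
  "'i set \<Rightarrow> ('i \<Rightarrow> 'i \<Rightarrow> bool) \<Rightarrow> ('i, 'a) diagram \<Rightarrow> ('i, 'a) diagram \<Rightarrow> bool"
where
  "weakly_equivalent P le = equivclp (elementary_equivalence P le)"


section \<open>Homotopy interleaving distance\<close>

definition bideg :: "(real \<times> real) set" where
  "bideg = {0<..} \<times> {0..}"

fun bideg_le :: "real \<times> real \<Rightarrow> real \<times> real \<Rightarrow> bool" where
  "bideg_le (m, r) (m', r') \<longleftrightarrow> m \<ge> m' \<and> r \<le> r'"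

fun bideg_shift :: "real \<Rightarrow> real \<times> real \<Rightarrow> real \<times> real" where
  "bideg_shift \<delta> (m, r) = (m - \<delta>, r + \<delta>)"

fun interleaving_le :: "real \<Rightarrow> (real \<times> real) \<times> nat \<Rightarrow> (real \<times> real) \<times> nat \<Rightarrow> bool" where
  "interleaving_le \<delta> (p, i) (q, j) \<longleftrightarrow>
     (i = j \<and> bideg_le p q) \<or> (i \<noteq> j \<and> bideg_le (bideg_shift \<delta> p) q)"

definition restricts_to :: "((real \<times> real) \<times> nat, 'a) diagram \<Rightarrow> nat \<Rightarrow> (real \<times> real, 'a) diagram \<Rightarrow> bool"
where
  "restricts_to H i F \<longleftrightarrow>
     (\<forall>p\<in>bideg. obj H (p, i) = obj F p) \<and>
     (\<forall>p\<in>bideg. \<forall>q\<in>bideg. bideg_le p q \<longrightarrow>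
        (\<forall>x\<in>topspace (obj F p). mor H (p, i) (q, i) x = mor F p q x))"

definition interleaved :: "real \<Rightarrow> (real \<times> real, 'a) diagram \<Rightarrow> (real \<times> real, 'a) diagram \<Rightarrow> bool"
where
  "interleaved \<delta> F G \<longleftrightarrow>
     (\<exists>H. top_functor (bideg \<times> {0, 1}) (interleaving_le \<delta>) H \<and>
          restricts_to H 0 F \<and> restricts_to H 1 G)"

text \<open>
  The functors \<open>F'\<close>, \<open>G'\<close> and the functors in the zig-zags take values in spaces on subsets of
  \<^typ>\<open>'a\<close>. Allowing a larger type can only decrease the infimum, so an upper bound for
  \<open>d_HI\<close> is an upper bound for the distance formed with any larger universe of spaces.
\<close>

definition d_HI :: "(real \<times> real, 'a) diagram \<Rightarrow> (real \<times> real, 'a) diagram \<Rightarrow> ennreal" where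
  "d_HI F G = Inf {ennreal \<delta> |\<delta>. 0 < \<delta> \<and>
     (\<exists>F' G'. weakly_equivalent bideg bideg_le F' F \<and> weakly_equivalent bideg bideg_le G' G \<and>
        interleaved \<delta> F' G')}"


section \<open>Measures and the measure Dowker bifiltration\<close>

definition thickening :: "real \<Rightarrow> 'z::metric_space set \<Rightarrow> 'z set" where
  "thickening \<epsilon> A = {z. \<exists>a\<in>A. dist a z \<le> \<epsilon>}"

text \<open>
  For closed \<open>A\<close> the set \<open>thickening \<epsilon> A\<close> need not be Borel, and \<^const>\<open>emeasure\<close> is \<open>0\<close> on
  non-measurable sets. In a Polish space it is analytic, hence measurable for the completion
  of every finite Borel measure.
\<close>

definition d_Pr :: "'z::metric_space measure \<Rightarrow> 'z measure \<Rightarrow> ennreal" where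
  "d_Pr \<mu> \<eta> = Inf {ennreal \<epsilon> |\<epsilon>. 0 < \<epsilon> \<and>
     (\<forall>A. closed A \<longrightarrow>
        emeasure \<mu> A \<le> emeasure (completion \<eta>) (thickening \<epsilon> A) + ennreal \<epsilon> \<and>
        emeasure \<eta> A \<le> emeasure (completion \<mu>) (thickening \<epsilon> A) + ennreal \<epsilon>)}"

definition empirical_measure :: "'z::topological_space set \<Rightarrow> 'z measure" where
  "empirical_measure Y =
     measure_of UNIV (sets borel) (\<lambda>A. (\<Sum>y\<in>Y. emeasure (return borel y) A) / of_nat (card Y))"

lemma sigma_sets_borel: "sigma_sets UNIV (sets borel) = sets (borel :: 'z::topological_space measure)"
  using sets.sigma_sets_eq[of borel] by simp

lemma emeasure_empirical_measure:
  assumes "A \<in> sets borel"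
  shows "emeasure (empirical_measure Y) A = (\<Sum>y\<in>Y. emeasure (return borel y) A) / of_nat (card Y)"
proof (rule emeasure_measure_of[OF empirical_measure_def])
  show "countably_additive (sets (empirical_measure Y))
      (\<lambda>A. (\<Sum>y\<in>Y. emeasure (return borel y) A) / of_nat (card Y))"
    unfolding countably_additive_def
  proof (intro allI impI)
    fix B :: "nat \<Rightarrow> 'a set"
    assume B: "range B \<subseteq> sets (empirical_measure Y)" "disjoint_family B"
    have s: "sets (empirical_measure Y) = sets borel"
      unfolding empirical_measure_def
      by (simp add: sigma_sets_borel)
    have "(\<Sum>i. (\<Sum>y\<in>Y. emeasure (return borel y) (B i)) / of_nat (card Y)) =
        (\<Sum>i. \<Sum>y\<in>Y. emeasure (return borel y) (B i)) / of_nat (card Y)"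
      by (simp add: divide_ennreal_def)
    also have "(\<Sum>i. \<Sum>y\<in>Y. emeasure (return borel y) (B i)) =
        (\<Sum>y\<in>Y. \<Sum>i. emeasure (return borel y) (B i))"
      by (rule suminf_sum) simp
    also have "\<dots> = (\<Sum>y\<in>Y. emeasure (return borel y) (\<Union>i. B i))"
      using B s by (intro sum.cong refl suminf_emeasure) auto
    finally show "(\<Sum>i. (\<Sum>y\<in>Y. emeasure (return borel y) (B i)) / of_nat (card Y)) =
        (\<Sum>y\<in>Y. emeasure (return borel y) (\<Union>i. B i)) / of_nat (card Y)" .
  qed
  show "A \<in> sets (empirical_measure Y)"
    using assms unfolding empirical_measure_def
    by (simp add: sigma_sets_borel)
qed (auto simp: positive_def)

definition measure_Dowker :: "'z::metric_space set \<Rightarrow> 'z measure \<Rightarrow> real \<times> real \<Rightarrow> 'z set set" where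
  "measure_Dowker X \<mu> = (\<lambda>(m, r). {\<sigma>. \<sigma> \<noteq> {} \<and> finite \<sigma> \<and> \<sigma> \<subseteq> X \<and>
     ennreal m \<le> emeasure \<mu> {z. \<forall>x\<in>\<sigma>. dist x z \<le> 2 * r}})"

text \<open>In barycentric coordinates the realization of an inclusion of complexes is the identity.\<close>

definition realized_MD ::
  "'z::metric_space set \<Rightarrow> 'z measure \<Rightarrow> (real \<times> real, 'z \<Rightarrow> real) diagram" where
  "realized_MD X \<mu> = \<lparr>obj = (\<lambda>p. realization (measure_Dowker X \<mu> p)), mor = (\<lambda>p q t. t)\<rparr>"

end

theory Submission
  imports Defs
begin

text \<open>
  Both bifiltrations consist of complexes on the same vertex set \<open>L\<close>; the two measures enter only
  through the weights that they give to the witness set of a simplex \<open>\<sigma>\<close> at scale \<open>r\<close>, the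
  intersection of the closed balls of radius \<open>2 * r\<close> around the points of \<open>\<sigma>\<close>. This
  intersection is closed, so the Prokhorov inequality for an admissible \<open>\<epsilon>\<close> applies to it, and
  by the triangle inequality its \<open>\<epsilon>\<close>-thickening lies in the witness set at scale \<open>r + \<epsilon>\<close>.
  Hence a simplex that has weight at least \<open>m\<close> at scale \<open>r\<close> for one measure has weight at
  least \<open>m - \<epsilon>\<close> at scale \<open>r + \<epsilon>\<close> for the other (\<open>measure_Dowker_shift\<close>). The two
  bifiltrations themselves are therefore \<open>\<epsilon>\<close>-interleaved, without passing to weakly
  equivalent functors: all maps of the interleaving are inclusions of subcomplexes, so all
  diagrams commute (\<open>interleaved_realized_MD\<close>). Every \<open>\<epsilon>\<close> admissible for \<open>d_Pr\<close> is
  thus admissible for \<open>d_HI\<close>.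

  It also has to be seen that the spaces belong to the category considered. The realization of
  a complex is Hausdorff, and it is compact if the complex is finite, as it is for finite \<open>L\<close>.
  A compact Hausdorff space is compactly generated, being its own test space, and weakly
  Hausdorff, since compact subsets are closed.
\<close>

section \<open>Realizations of finite complexes\<close>

lemma compact_closed_simplex:
  assumes "finite \<sigma>"
  shows "compact (closed_simplex \<sigma>)"
proof -
  let ?C = "PiE UNIV (\<lambda>v. if v \<in> \<sigma> then {0..1} else {0::real})"
  let ?S = "{t :: 'a \<Rightarrow> real. (\<Sum>v\<in>\<sigma>. t v) = 1}"
  have eq: "closed_simplex \<sigma> = ?C \<inter> ?S"
  proof (intro equalityI subsetI)
    fix t assume t: "t \<in> closed_simplex \<sigma>"
    have "t v \<le> 1" if "v \<in> \<sigma>" for v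
    proof -
      have "t v \<le> (\<Sum>v\<in>\<sigma>. t v)"
        using t that assms by (intro member_le_sum) (auto simp: closed_simplex_def)
      then show ?thesis using t by (simp add: closed_simplex_def)
    qed
    then show "t \<in> ?C \<inter> ?S" using t by (auto simp: closed_simplex_def)
  next
    fix t assume t: "t \<in> ?C \<inter> ?S"
    have v: "t v \<in> (if v \<in> \<sigma> then {0..1} else {0})" for v
      by (rule PiE_mem[OF IntD1[OF t]]) simp
    have "0 \<le> t v" "v \<notin> \<sigma> \<Longrightarrow> t v = 0" for v
      using v[of v] by (auto split: if_splits)
    then show "t \<in> closed_simplex \<sigma>"
      using t unfolding closed_simplex_def by blast
  qed
  have "compactin (product_topology (\<lambda>v. euclidean) UNIV) ?C"
    unfolding compactin_PiE by auto
  then have "compact ?C"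
    by (simp add: euclidean_product_topology)
  moreover have "closed ?S"
    by (intro closed_Collect_eq continuous_intros continuous_on_product_coordinates)
  ultimately show ?thesis
    unfolding eq by (rule compact_Int_closed)
qed

lemma continuous_map_into_realization:
  assumes "\<sigma> \<in> K"
  shows "continuous_map (top_of_set (closed_simplex \<sigma>)) (realization K) (\<lambda>t. t)"
  unfolding continuous_map_def
proof (intro conjI allI impI)
  show "(\<lambda>t. t) \<in> topspace (top_of_set (closed_simplex \<sigma>)) \<rightarrow> topspace (realization K)"
    using assms by (auto simp: topspace_realization)
  fix U assume "openin (realization K) U"
  moreover have "{x \<in> topspace (top_of_set (closed_simplex \<sigma>)). x \<in> U} = U \<inter> closed_simplex \<sigma>"
    by auto
  ultimately show "openin (top_of_set (closed_simplex \<sigma>))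
      {x \<in> topspace (top_of_set (closed_simplex \<sigma>)). x \<in> U}"
    using assms by (simp add: openin_realization)
qed

lemma continuous_map_realization_mono:
  assumes "K \<subseteq> K'"
  shows "continuous_map (realization K) (realization K') (\<lambda>t. t)"
  unfolding continuous_map_def
proof (intro conjI allI impI)
  show "(\<lambda>t. t) \<in> topspace (realization K) \<rightarrow> topspace (realization K')"
    using assms by (auto simp: topspace_realization)
  fix U assume U: "openin (realization K') U"
  have "{x \<in> topspace (realization K). x \<in> U} \<inter> closed_simplex \<sigma> = U \<inter> closed_simplex \<sigma>"
    if "\<sigma> \<in> K" for \<sigma>
    using that by (auto simp: topspace_realization)
  then show "openin (realization K) {x \<in> topspace (realization K). x \<in> U}"
    using U assms by (auto simp: openin_realization topspace_realization)
qed

lemma compact_space_realization: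
  assumes "finite K" and "\<And>\<sigma>. \<sigma> \<in> K \<Longrightarrow> finite \<sigma>"
  shows "compact_space (realization K)"
proof -
  have "compactin (realization K) (closed_simplex \<sigma>)" if "\<sigma> \<in> K" for \<sigma>
  proof -
    have "compactin (top_of_set (closed_simplex \<sigma>)) (closed_simplex \<sigma>)"
      using compact_closed_simplex[OF assms(2)[OF that]] by (simp add: compactin_subtopology)
    from image_compactin[OF this continuous_map_into_realization[OF that]]
    show ?thesis by simp
  qed
  then have "compactin (realization K) (\<Union>\<sigma>\<in>K. closed_simplex \<sigma>)"
    using assms(1) by (intro compactin_Union) auto
  then show ?thesis by (simp add: compact_space_def topspace_realization)
qed

text \<open>
  The weak topology is finer than the topology of pointwise convergence of barycentric
  coordinates, which is Hausdorff.
\<close>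

lemma Hausdorff_space_realization: "Hausdorff_space (realization K)"
  unfolding Hausdorff_space_def
proof (intro allI impI)
  fix x y
  assume xy: "x \<in> topspace (realization K) \<and> y \<in> topspace (realization K) \<and> x \<noteq> y"
  have o: "openin (realization K) (topspace (realization K) \<inter> U)" if "open U" for U
    unfolding openin_realization
  proof (intro conjI ballI)
    show "topspace (realization K) \<inter> U \<subseteq> (\<Union>\<sigma>\<in>K. closed_simplex \<sigma>)"
      by (auto simp: topspace_realization)
    fix \<sigma> assume "\<sigma> \<in> K"
    then have "topspace (realization K) \<inter> U \<inter> closed_simplex \<sigma> = closed_simplex \<sigma> \<inter> U"
      by (auto simp: topspace_realization)
    then show "openin (top_of_set (closed_simplex \<sigma>))
        (topspace (realization K) \<inter> U \<inter> closed_simplex \<sigma>)"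
      using that by (simp add: openin_open_Int)
  qed
  obtain v where "x v \<noteq> y v" using xy by auto
  then obtain A B where AB: "open A" "open B" "x v \<in> A" "y v \<in> B" "A \<inter> B = {}"
    by (meson hausdorff)
  let ?pre = "\<lambda>S. (\<lambda>t :: 'a \<Rightarrow> real. t v) -` S"
  have pre: "open (?pre S)" if "open S" for S
    using that by (intro open_vimage continuous_on_product_coordinates)
  show "\<exists>U V. openin (realization K) U \<and> openin (realization K) V \<and> x \<in> U \<and> y \<in> V \<and> disjnt U V"
    using xy AB o[OF pre[OF AB(1)]] o[OF pre[OF AB(2)]]
    by (intro exI[of _ "topspace (realization K) \<inter> ?pre A"]
        exI[of _ "topspace (realization K) \<inter> ?pre B"]) (auto simp: disjnt_def)
qed

text \<open>
  For compact generation the space is its own test space. The definition wants test spaces on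
  \<^typ>\<open>'a set set\<close>, so the topology is transported along the injection \<open>x \<mapsto> {{x}}\<close>.
\<close>

lemma compact_Hausdorff_imp_CGWH_space:
  fixes X :: "'a topology"
  assumes "compact_space X" and "Hausdorff_space X"
  shows "CGWH_space X"
  unfolding CGWH_space_def
proof
  let ?u = "\<lambda>c :: 'a set set. the_elem (the_elem c)"
  let ?C = "pullback_topology ((\<lambda>x. {{x}}) ` topspace X) ?u X"
  have u: "homeomorphic_map ?C X ?u"
  proof (rule bijective_open_imp_homeomorphic_map)
    have top: "topspace ?C = (\<lambda>x. {{x}}) ` topspace X"
      by (auto simp: topspace_pullback_topology)
    show "continuous_map ?C X ?u"
      using continuous_map_pullback[of X X id] by (simp add: comp_def)
    show "?u ` topspace ?C = topspace X" "inj_on ?u (topspace ?C)"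
      by (auto simp: top image_image inj_on_def)
    show "open_map ?C X ?u"
      unfolding open_map_def openin_pullback_topology
    proof (intro allI impI)
      fix V assume "\<exists>U. openin X U \<and> V = ?u -` U \<inter> (\<lambda>x. {{x}}) ` topspace X"
      then obtain U where U: "openin X U" "V = ?u -` U \<inter> (\<lambda>x. {{x}}) ` topspace X"
        by blast
      from openin_subset[OF U(1)] have "V = (\<lambda>x. {{x}}) ` U"
        unfolding U(2) by auto
      then show "openin X (?u ` V)"
        using U(1) by (simp add: image_image)
    qed
  qed
  then have C: "compact_space ?C" "Hausdorff_space ?C"
    using assms homeomorphic_compact_space homeomorphic_Hausdorff_space homeomorphic_map_imp_homeomorphic_space
    by blast+
  show "compactly_generated_space X"
    unfolding compactly_generated_space_def
  proof (intro allI impI)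
    fix A assume A: "A \<subseteq> topspace X"
      and test: "\<forall>(C :: 'a set set topology) u.
        compact_space C \<and> Hausdorff_space C \<and> continuous_map C X u \<longrightarrow>
        closedin C {c \<in> topspace C. u c \<in> A}"
    have "closedin ?C {c \<in> topspace ?C. ?u c \<in> A}"
      using test C homeomorphic_imp_continuous_map[OF u] by blast
    then have "closedin X (?u ` {c \<in> topspace ?C. ?u c \<in> A})"
      using homeomorphic_imp_closed_map[OF u] by (auto simp: closed_map_def)
    moreover have "?u ` {c \<in> topspace ?C. ?u c \<in> A} = A"
      using A homeomorphic_imp_surjective_map[OF u] by auto
    ultimately show "closedin X A" by simp
  qed
  show "weakly_Hausdorff_space X"
    unfolding weakly_Hausdorff_space_def compact_space_def
    using assms(2) compactin_imp_closedin image_compactin by blast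
qed

section \<open>Stability of the measure Dowker bifiltration\<close>

lemma closed_common_witnesses: "closed {z :: 'z::metric_space. \<forall>x\<in>\<sigma>. dist x z \<le> c}"
proof -
  have "{z. \<forall>x\<in>\<sigma>. dist x z \<le> c} = (\<Inter>x\<in>\<sigma>. cball x c)" by auto
  then show ?thesis by (simp add: closed_INT)
qed

lemma measure_Dowker_mono:
  assumes "sets \<mu> = sets borel" and "bideg_le p q"
  shows "measure_Dowker X \<mu> p \<subseteq> measure_Dowker X \<mu> q"
proof
  fix \<sigma> assume \<sigma>: "\<sigma> \<in> measure_Dowker X \<mu> p"
  obtain m r m' r' where pq: "p = (m, r)" "q = (m', r')" by fastforce
  with assms(2) have le: "m' \<le> m" "r \<le> r'" by auto
  have "closed {z. \<forall>x\<in>\<sigma>. dist x z \<le> 2 * r'}"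
    by (rule closed_common_witnesses)
  then have "emeasure \<mu> {z. \<forall>x\<in>\<sigma>. dist x z \<le> 2 * r} \<le> emeasure \<mu> {z. \<forall>x\<in>\<sigma>. dist x z \<le> 2 * r'}"
    using le assms(1) by (intro emeasure_mono) fastforce+
  then show "\<sigma> \<in> measure_Dowker X \<mu> q"
    using \<sigma> le unfolding pq measure_Dowker_def by (auto intro: order_trans ennreal_leI)
qed

text \<open>
  The thickening of the witness set enters through the completion of \<open>\<eta>\<close>; it is enclosed in the
  closed witness set at scale \<open>r + \<epsilon>\<close>, on which \<open>\<eta>\<close> and its completion agree.
\<close>

lemma measure_Dowker_shift:
  assumes "sets \<eta> = sets borel" and "0 < \<epsilon>"
    and Pr: "\<And>A. closed A \<Longrightarrow> emeasure \<mu> A \<le> emeasure (completion \<eta>) (thickening \<epsilon> A) + ennreal \<epsilon>"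
  shows "measure_Dowker X \<mu> p \<subseteq> measure_Dowker X \<eta> (bideg_shift \<epsilon> p)"
proof
  fix \<sigma> assume \<sigma>: "\<sigma> \<in> measure_Dowker X \<mu> p"
  obtain m r where p: "p = (m, r)" by fastforce
  let ?D = "\<lambda>r. {z. \<forall>x\<in>\<sigma>. dist x z \<le> 2 * r}"
  have closed: "closed (?D r)" for r
    by (rule closed_common_witnesses)
  then have D: "?D (r + \<epsilon>) \<in> sets \<eta>" unfolding assms(1) by (rule borel_closed)
  have sub: "thickening \<epsilon> (?D r) \<subseteq> ?D (r + \<epsilon>)"
  proof
    fix z assume "z \<in> thickening \<epsilon> (?D r)"
    then obtain a where a: "a \<in> ?D r" "dist a z \<le> \<epsilon>" by (auto simp: thickening_def)
    have "dist x z \<le> 2 * (r + \<epsilon>)" if "x \<in> \<sigma>" for x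
      using a that dist_triangle[of x z a] \<open>0 < \<epsilon>\<close> by fastforce
    then show "z \<in> ?D (r + \<epsilon>)" by simp
  qed
  have "ennreal m \<le> emeasure \<mu> (?D r)"
    using \<sigma> by (simp add: p measure_Dowker_def)
  also have "\<dots> \<le> emeasure (completion \<eta>) (thickening \<epsilon> (?D r)) + ennreal \<epsilon>"
    by (rule Pr[OF closed])
  also have "\<dots> \<le> emeasure (completion \<eta>) (?D (r + \<epsilon>)) + ennreal \<epsilon>"
    using sub D by (intro add_mono emeasure_mono) auto
  also have "emeasure (completion \<eta>) (?D (r + \<epsilon>)) = emeasure \<eta> (?D (r + \<epsilon>))"
    using D by simp
  finally have "ennreal (m - \<epsilon>) \<le> emeasure \<eta> (?D (r + \<epsilon>))"
    using \<open>0 < \<epsilon>\<close> by (simp add: ennreal_minus[symmetric] ennreal_minus_le_iff add.commute)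
  then show "\<sigma> \<in> measure_Dowker X \<eta> (bideg_shift \<epsilon> p)"
    using \<sigma> by (simp add: p measure_Dowker_def)
qed

lemma CGWH_space_realization_measure_Dowker:
  assumes "finite L"
  shows "CGWH_space (realization (measure_Dowker L \<mu> p))"
proof (rule compact_Hausdorff_imp_CGWH_space[OF compact_space_realization Hausdorff_space_realization])
  show "finite (measure_Dowker L \<mu> p)"
    by (rule finite_subset[of _ "Pow L"]) (use assms in \<open>auto simp: measure_Dowker_def split: prod.splits\<close>)
  show "finite \<sigma>" if "\<sigma> \<in> measure_Dowker L \<mu> p" for \<sigma>
    using that by (auto simp: measure_Dowker_def split: prod.splits)
qed

text \<open>The functor on the interleaving category has inclusions of subcomplexes as its only maps.\<close>

lemma interleaved_realized_MD:
  assumes "finite L" and [simp]: "sets \<mu> = sets borel" "sets \<eta> = sets borel" and "0 < \<epsilon>"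
    and "\<And>A. closed A \<Longrightarrow> emeasure \<mu> A \<le> emeasure (completion \<eta>) (thickening \<epsilon> A) + ennreal \<epsilon>"
    and "\<And>A. closed A \<Longrightarrow> emeasure \<eta> A \<le> emeasure (completion \<mu>) (thickening \<epsilon> A) + ennreal \<epsilon>"
  shows "interleaved \<epsilon> (realized_MD L \<mu>) (realized_MD L \<eta>)"
proof -
  define M where "M i = (if i = (0::nat) then \<mu> else \<eta>)" for i
  let ?H = "\<lparr>obj = (\<lambda>(p, i). realization (measure_Dowker L (M i) p)), mor = (\<lambda>p q t. t)\<rparr>"
  have incl: "measure_Dowker L (M i) p \<subseteq> measure_Dowker L (M j) q"
    if "i \<in> {0, 1}" "j \<in> {0, 1}" "interleaving_le \<epsilon> (p, i) (q, j)" for p q i j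
  proof (cases "i = j")
    case True
    with that have "bideg_le p q" by simp
    then have "measure_Dowker L (M i) p \<subseteq> measure_Dowker L (M i) q"
      by (intro measure_Dowker_mono) (simp_all add: M_def)
    with True show ?thesis by simp
  next
    case False
    with that have "measure_Dowker L (M j) (bideg_shift \<epsilon> p) \<subseteq> measure_Dowker L (M j) q"
      by (intro measure_Dowker_mono) (auto simp: M_def)
    moreover have "measure_Dowker L (M i) p \<subseteq> measure_Dowker L (M j) (bideg_shift \<epsilon> p)"
      using False that(1,2) assms(4-6) by (intro measure_Dowker_shift) (auto simp: M_def)
    ultimately show ?thesis by blast
  qed
  have "top_functor (bideg \<times> {0, 1}) (interleaving_le \<epsilon>) ?H"
    unfolding top_functor_def
  proof (intro conjI ballI impI)
    fix a b assume "a \<in> bideg \<times> {0::nat, 1}" "b \<in> bideg \<times> {0::nat, 1}" "interleaving_le \<epsilon> a b"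
    then have "measure_Dowker L (M (snd a)) (fst a) \<subseteq> measure_Dowker L (M (snd b)) (fst b)"
      by (intro incl) (auto simp del: interleaving_le.simps)
    then show "continuous_map (obj ?H a) (obj ?H b) (mor ?H a b)"
      by (simp add: case_prod_beta continuous_map_realization_mono)
  qed (simp_all add: case_prod_beta CGWH_space_realization_measure_Dowker[OF \<open>finite L\<close>])
  moreover have "restricts_to ?H 0 (realized_MD L \<mu>)" "restricts_to ?H 1 (realized_MD L \<eta>)"
    by (simp_all add: restricts_to_def realized_MD_def M_def)
  ultimately show ?thesis unfolding interleaved_def by blast
qed

lemma d_HI_realized_MD_le_d_Pr:
  assumes "finite L" and "sets \<mu> = sets borel" and "sets \<eta> = sets borel"
  shows "d_HI (realized_MD L \<mu>) (realized_MD L \<eta>) \<le> d_Pr \<mu> \<eta>"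
  unfolding d_HI_def d_Pr_def
proof (rule Inf_superset_mono, safe)
  fix \<epsilon> :: real
  assume "0 < \<epsilon>" and "\<forall>A. closed A \<longrightarrow>
      emeasure \<mu> A \<le> emeasure (completion \<eta>) (thickening \<epsilon> A) + ennreal \<epsilon> \<and>
      emeasure \<eta> A \<le> emeasure (completion \<mu>) (thickening \<epsilon> A) + ennreal \<epsilon>"
  then have "interleaved \<epsilon> (realized_MD L \<mu>) (realized_MD L \<eta>)"
    using assms by (intro interleaved_realized_MD) auto
  moreover have "weakly_equivalent bideg bideg_le F F" for F :: "(real \<times> real, 'a \<Rightarrow> real) diagram"
    by (simp add: weakly_equivalent_def)
  ultimately show "\<exists>\<delta>. ennreal \<epsilon> = ennreal \<delta> \<and> 0 < \<delta> \<and>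
      (\<exists>F' G'. weakly_equivalent bideg bideg_le F' (realized_MD L \<mu>) \<and>
        weakly_equivalent bideg bideg_le G' (realized_MD L \<eta>) \<and> interleaved \<delta> F' G')"
    using \<open>0 < \<epsilon>\<close> by blast
qed

lemma sets_empirical_measure: "sets (empirical_measure Y) = sets borel"
  unfolding empirical_measure_def by (simp add: sigma_sets_borel)

theorem corollary4p10:
  fixes L Y1 Y2 :: "'z::polish_space set"
  assumes "finite L"
    and "finite Y1" and "Y1 \<noteq> {}"
    and "finite Y2" and "Y2 \<noteq> {}"
  shows "d_HI (realized_MD L (empirical_measure Y1)) (realized_MD L (empirical_measure Y2))
    \<le> d_Pr (empirical_measure Y1) (empirical_measure Y2)"
  by (intro d_HI_realized_MD_le_d_Pr[OF assms(1)] sets_empirical_measure)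

end
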